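(* Let $S$ be a finite set of observed random variables, $\mathscr A$ a set of affects relations over $S$ (known to be present, some of them known to be irreducible) and $\mathscr B$ a set of affects relations over $S$ known to be absent. If the extended loop graph $\mathcal G^\circ$ of $(\mathscr A,\mathscr B)$ is not empty, then $\mathscr A$ and $\mathscr B$ imply the presence of an affects causal loop: every causal model over $S$ in which all relations of $\mathscr A$ hold (those designated irreducible being irreducible) and all relations of $\mathscr B$ fail has a causal structure containing a directed cycle.
   Context: Causal structure. A causal structure is a directed graph $\mathcal G$ whose nodes are either observed or unobserved; the observed nodes form a finite set $S$ of (discrete) random variables, while unobserved nodes may be arbitrary systems (classical, quantum, or of a generalized probabilistic theory). For disjoint node sets, $X$ and $Y$ are d-separated by $Z$ if every undirected path between an element of $X$ and an element of $Y$ is blocked by $Z$, i.e. contains a segment $A\to V\to B$ or $A\leftarrow V\to B$ with $V\in Z$, or a collider $A\to V\leftarrow B$ such that neither $V$ nor any descendant of $V$ is in $Z$. A distribution over the observed nodes is compatible with the graph if d-separation of disjoint observed sets $X,Y$ by observed $Z$ implies $P(XY|Z)=P(X|Z)P(Y|Z)$. Causal model and interventions. A causal model over $S$ is such a graph $\mathcal G$ with a compatible distribution $P_{\mathcal G}$ over $S$, together with intervention data: for $X\subseteq S$, the augmented graph $\mathcal G_{I_X}$ adds for each $e\in X$ a parentless observed node $I_e$ with an edge $I_e\to e$ (values: "idle", or $\mathrm{do}(x)$ for values $x$ of $e$), and $\mathcal G_{\mathrm{do}(X)}$ is obtained from $\mathcal G_{I_X}$ by deleting all edges into $X$ other than those from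 $I_X$. Both carry compatible distributions with $P_{\mathcal G_{I_X}}(\cdot|I_X=\text{idle})=P_{\mathcal G}(\cdot)$, $P_{\mathcal G_{I_X}}(\cdot|I_X=\mathrm{do}(x))=P_{\mathcal G_{\mathrm{do}(X)}}(\cdot|I_X=\mathrm{do}(x))=P_{\mathcal G_{\mathrm{do}(X)}}(\cdot|X=x)$, and $I_X=\mathrm{do}(x)$ forces $X=x$. The same construction is applied to post-intervention models $\mathcal G_{\mathrm{do}(Z)}$ (intervening on $X$ there gives $\mathcal G_{\mathrm{do}(X\cup Z)}$). All conditional distributions that appear are assumed well-defined. Affects relations. For pairwise disjoint $X,Y,Z,W\subseteq S$ with $X,Y$ non-empty, $X\models Y\mid\{\mathrm{do}(Z),W\}$ holds if there exist values $x,z,w$ with $$P_{\mathcal G_{\mathrm{do}(X\cup Z)}}(Y| X=x,Z=z,W=w)\neq P_{\mathcal G_{\mathrm{do}(Z)}}(Y| Z=z,W=w).$$ It is reducible if $s_X\not\models Y\mid\{\mathrm{do}(Z\cup(X\setminus s_X)),W\}$ for some non-empty $s_X\subsetneq X$, and irreducible otherwise. Extended potential cause graph of $(\mathscr A,\mathscr B)$: node set $S$ and labelled arrows as follows. (a) For each relation $X\models Y_1\mid\{\mathrm{do}(Z),Y_2\}$ in $\mathscr A$ that is irreducible, an arrow $e_X\vdash_T e_Y$ for all $e_X\in X$, $e_Y\in T:=Y_1\cup Y_2$. (b) For each relation $X\models Y_1\mid\{\mathrm{do}(Z),Y_2\}$ in $\mathscr A$ and each $e_Z\in Z$ such that the relation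 from $X$ to $Y_1$ given $\{\mathrm{do}(Z\setminus\{e_Z\}),Y_2\}$ is in $\mathscr B$ (known absent), an arrow $e_Z\vdash_T e_Y$ for all $e_Y\in T:=Y_1\cup Y_2$. (Arrows between the same nodes with different labels are distinct.) Extended loop graph $\mathcal G^\circ$: obtained from the extended potential cause graph by repeating the following until every remaining node has a child: remove any node $e_Y$ without children together with all its incoming arrows $e_X\vdash_A e_Y$; and for each arrow $e_X\vdash_A e_Y$ so removed, also remove all other arrows $e_X\vdash_A e_W$ from $e_X$ with the same label $A$. (Optionally, nodes without parents may also be recursively removed.) It is empty if no node remains. *)

theory Defs
  imports "HOL-Probability.Probability"
begin

section \<open>Causal structures and d-separation\<close>

text \<open>
  A causal structure is a directed graph, possibly cyclic, given by its set of edges.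
  Its nodes are observed variables \<open>Obs e\<close> or unobserved systems \<open>Hid u\<close>;
  \<open>Interv e\<close> is the intervention node written \<open>I_e\<close> on paper.
\<close>

datatype ('v, 'u) node = Obs 'v | Hid 'u | Interv 'v

text \<open>
  A path is a list of nodes \<open>p\<close> together with the orientation \<open>d\<close> of each of
  its edges: \<open>d ! i\<close> says that the \<open>i\<close>-th edge points forwards along the path.
  The orientation is part of the path because a cyclic graph may contain edges in both directions
  between two nodes.
\<close>

definition undirected_path :: "('n \<times> 'n) set \<Rightarrow> 'n list \<Rightarrow> bool list \<Rightarrow> bool" where
  "undirected_path E p d \<longleftrightarrow>
     length p = Suc (length d) \<and> distinct p \<and>
     (\<forall>i < length d. (if d ! i then (p ! i, p ! Suc i) else (p ! Suc i, p ! i)) \<in> E)"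

text \<open>
  The inner node \<open>p ! Suc i\<close> is a collider iff the edge before it points forwards and the
  edge after it points backwards.
\<close>

definition blocked :: "('n \<times> 'n) set \<Rightarrow> 'n set \<Rightarrow> 'n list \<Rightarrow> bool list \<Rightarrow> bool" where
  "blocked E Z p d \<longleftrightarrow>
     (\<exists>i. Suc i < length d \<and>
        (if d ! i \<and> \<not> d ! Suc i then \<forall>z\<in>Z. (p ! Suc i, z) \<notin> E\<^sup>*
         else p ! Suc i \<in> Z))"

definition d_separated :: "('n \<times> 'n) set \<Rightarrow> 'n set \<Rightarrow> 'n set \<Rightarrow> 'n set \<Rightarrow> bool" where
  "d_separated E X Y Z \<longleftrightarrow>
     (\<forall>p d. undirected_path E p d \<and> hd p \<in> X \<and> last p \<in> Y \<longrightarrow> blocked E Z p d)"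

section \<open>Compatible distributions\<close>

definition agree :: "'n set \<Rightarrow> ('n \<Rightarrow> 'b) \<Rightarrow> ('n \<Rightarrow> 'b) set" where
  "agree X s = {\<omega>. \<forall>n\<in>X. \<omega> n = s n}"

text \<open>
  One assignment \<open>s\<close> supplies the values of the three sets, which are pairwise disjoint
  wherever this is used. Only conditions of positive probability are considered
  (otherwise \<^const>\<open>cond_pmf\<close> is meaningless).
\<close>

definition cond_indep :: "('n \<Rightarrow> 'b) pmf \<Rightarrow> 'n set \<Rightarrow> 'n set \<Rightarrow> 'n set \<Rightarrow> bool" where
  "cond_indep P X Y Z \<longleftrightarrow>
     (\<forall>s. measure_pmf.prob P (agree Z s) > 0 \<longrightarrow>
        measure_pmf.prob (cond_pmf P (agree Z s)) (agree (X \<union> Y) s) =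
        measure_pmf.prob (cond_pmf P (agree Z s)) (agree X s) *
        measure_pmf.prob (cond_pmf P (agree Z s)) (agree Y s))"

definition compatible :: "('n \<times> 'n) set \<Rightarrow> 'n set \<Rightarrow> ('n \<Rightarrow> 'b) pmf \<Rightarrow> bool" where
  "compatible E N P \<longleftrightarrow>
     (\<forall>X Y Z. X \<subseteq> N \<and> Y \<subseteq> N \<and> Z \<subseteq> N \<and> X \<inter> Y = {} \<and> X \<inter> Z = {} \<and> Y \<inter> Z = {} \<and>
        d_separated E X Y Z \<longrightarrow> cond_indep P X Y Z)"

section \<open>Causal models with interventions\<close>

datatype 'a val = Val 'a | Idle | Do 'a

text \<open>
  The graph obtained by first intervening on \<open>Z\<close> and then augmenting with intervention nodes
  for \<open>X\<close>: with \<open>Z = {}\<close> it is the augmented graph of \<open>X\<close>, with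
  \<open>X = {}\<close> the post-intervention graph of \<open>Z\<close>.
\<close>

definition interv_graph ::
  "(('v, 'u) node \<times> ('v, 'u) node) set \<Rightarrow> 'v set \<Rightarrow> 'v set \<Rightarrow> (('v, 'u) node \<times> ('v, 'u) node) set"
  where
  "interv_graph E Z X =
     {(a, b) \<in> E. b \<notin> Obs ` Z} \<union> (\<lambda>e. (Interv e, Obs e)) ` (Z \<union> X)"

definition observed_nodes :: "'v set \<Rightarrow> 'v set \<Rightarrow> ('v, 'u) node set" where
  "observed_nodes S X = Obs ` S \<union> Interv ` X"

primrec node_vals :: "('v \<Rightarrow> 'a set) \<Rightarrow> ('v, 'u) node \<Rightarrow> 'a val set" where
  "node_vals V (Obs e) = Val ` V e"
| "node_vals V (Hid u) = {}"
| "node_vals V (Interv e) = insert Idle (Do ` V e)"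

definition obs_event :: "'v set \<Rightarrow> ('v \<Rightarrow> 'a) \<Rightarrow> (('v, 'u) node \<Rightarrow> 'a val) set" where
  "obs_event X x = {\<omega>. \<forall>e\<in>X. \<omega> (Obs e) = Val (x e)}"

definition do_event :: "'v set \<Rightarrow> ('v \<Rightarrow> 'a) \<Rightarrow> (('v, 'u) node \<Rightarrow> 'a val) set" where
  "do_event X x = {\<omega>. \<forall>e\<in>X. \<omega> (Interv e) = Do (x e)}"

definition idle_event :: "'v set \<Rightarrow> (('v, 'u) node \<Rightarrow> 'a val) set" where
  "idle_event X = {\<omega>. \<forall>e\<in>X. \<omega> (Interv e) = Idle}"

definition marginal ::
  "'v set \<Rightarrow> (('v, 'u) node \<Rightarrow> 'a val) pmf \<Rightarrow> (('v, 'u) node \<Rightarrow> 'a val) pmf" where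
  "marginal X P = map_pmf (\<lambda>\<omega>. restrict \<omega> (Obs ` X)) P"

text \<open>
  \<open>D Z X\<close> is the distribution belonging to \<^term>\<open>interv_graph E Z X\<close>, so that
  \<open>D {} {}\<close> is the original distribution, \<open>D {} X\<close> the one of the augmented
  model and \<open>D Z {}\<close> the one of the post-intervention model of \<open>Z\<close>.
  \<open>D Z X\<close> is only constrained for disjoint subsets \<open>Z\<close> and \<open>X\<close> of
  \<open>S\<close>. The positivity conditions are the well-definedness of the conditional distributions
  in the axioms that follow them. These axioms compare distributions of the variables in
  \<open>S\<close>.
\<close>

locale causal_model =
  fixes S :: "'v set"
    and U :: "'u set"
    and E :: "(('v, 'u) node \<times> ('v, 'u) node) set"
    and V :: "'v \<Rightarrow> 'a set"
    and D :: "'v set \<Rightarrow> 'v set \<Rightarrow> (('v, 'u) node \<Rightarrow> 'a val) pmf"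
  assumes finite_observed: "finite S"
    and edges: "E \<subseteq> (Obs ` S \<union> Hid ` U) \<times> (Obs ` S \<union> Hid ` U)"
    and support: "\<lbrakk>Z \<subseteq> S; X \<subseteq> S; Z \<inter> X = {}\<rbrakk> \<Longrightarrow>
      set_pmf (D Z X) \<subseteq> Pi\<^sub>E (observed_nodes S (Z \<union> X)) (node_vals V)"
    and compatible: "\<lbrakk>Z \<subseteq> S; X \<subseteq> S; Z \<inter> X = {}\<rbrakk> \<Longrightarrow>
      compatible (interv_graph E Z X) (observed_nodes S (Z \<union> X)) (D Z X)"
    and do_forces: "\<lbrakk>Z \<subseteq> S; X \<subseteq> S; Z \<inter> X = {}; e \<in> Z \<union> X; \<omega> \<in> set_pmf (D Z X);
      \<omega> (Interv e) = Do a\<rbrakk> \<Longrightarrow> \<omega> (Obs e) = Val a"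
    and idle_pos: "\<lbrakk>Z \<subseteq> S; X \<subseteq> S; Z \<inter> X = {}\<rbrakk> \<Longrightarrow>
      measure_pmf.prob (D Z X) (idle_event X) > 0"
    and do_pos: "\<lbrakk>Z \<subseteq> S; X \<subseteq> S; Z \<inter> X = {}; \<And>e. e \<in> X \<Longrightarrow> x e \<in> V e\<rbrakk> \<Longrightarrow>
      measure_pmf.prob (D Z X) (do_event X x) > 0"
    and post_do_pos: "\<lbrakk>Z \<subseteq> S; X \<subseteq> S; Z \<inter> X = {}; \<And>e. e \<in> X \<Longrightarrow> x e \<in> V e\<rbrakk> \<Longrightarrow>
      measure_pmf.prob (D (Z \<union> X) {}) (do_event X x) > 0"
    and idle: "\<lbrakk>Z \<subseteq> S; X \<subseteq> S; Z \<inter> X = {}\<rbrakk> \<Longrightarrow>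
      marginal S (cond_pmf (D Z X) (idle_event X)) = marginal S (D Z {})"
    and augmented_do: "\<lbrakk>Z \<subseteq> S; X \<subseteq> S; Z \<inter> X = {}; \<And>e. e \<in> X \<Longrightarrow> x e \<in> V e\<rbrakk> \<Longrightarrow>
      marginal S (cond_pmf (D Z X) (do_event X x)) =
      marginal S (cond_pmf (D (Z \<union> X) {}) (do_event X x))"
    and post_do: "\<lbrakk>Z \<subseteq> S; X \<subseteq> S; Z \<inter> X = {}; \<And>e. e \<in> X \<Longrightarrow> x e \<in> V e\<rbrakk> \<Longrightarrow>
      marginal S (cond_pmf (D (Z \<union> X) {}) (do_event X x)) =
      marginal S (cond_pmf (D (Z \<union> X) {}) (obs_event X x))"

section \<open>Affects relations\<close>

text \<open>
  \<open>Rel X Y Z W\<close> stands for \<open>X \<Turnstile> Y | {do(Z), W}\<close>.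
\<close>

datatype 'v affects_rel = Rel "'v set" "'v set" "'v set" "'v set"

primrec rel_over :: "'v set \<Rightarrow> 'v affects_rel \<Rightarrow> bool" where
  "rel_over S (Rel X Y Z W) \<longleftrightarrow>
     X \<subseteq> S \<and> Y \<subseteq> S \<and> Z \<subseteq> S \<and> W \<subseteq> S \<and> X \<noteq> {} \<and> Y \<noteq> {} \<and>
     X \<inter> Y = {} \<and> X \<inter> Z = {} \<and> X \<inter> W = {} \<and> Y \<inter> Z = {} \<and> Y \<inter> W = {} \<and> Z \<inter> W = {}"

text \<open>
  The assignment \<open>s\<close> supplies the values of \<open>X\<close>, \<open>Z\<close> and
  \<open>W\<close>; positivity makes both conditional distributions well-defined (and the values
  admissible).
\<close>

primrec affects ::
  "('v set \<Rightarrow> 'v set \<Rightarrow> (('v, 'u) node \<Rightarrow> 'a val) pmf) \<Rightarrow> 'v affects_rel \<Rightarrow> bool" where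
  "affects D (Rel X Y Z W) \<longleftrightarrow>
     (\<exists>s. measure_pmf.prob (D (X \<union> Z) {}) (obs_event (X \<union> Z \<union> W) s) > 0 \<and>
          measure_pmf.prob (D Z {}) (obs_event (Z \<union> W) s) > 0 \<and>
          marginal Y (cond_pmf (D (X \<union> Z) {}) (obs_event (X \<union> Z \<union> W) s)) \<noteq>
          marginal Y (cond_pmf (D Z {}) (obs_event (Z \<union> W) s)))"

primrec reducible ::
  "('v set \<Rightarrow> 'v set \<Rightarrow> (('v, 'u) node \<Rightarrow> 'a val) pmf) \<Rightarrow> 'v affects_rel \<Rightarrow> bool" where
  "reducible D (Rel X Y Z W) \<longleftrightarrow>
     (\<exists>s. s \<noteq> {} \<and> s \<subset> X \<and> \<not> affects D (Rel s Y (Z \<union> (X - s)) W))"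

section \<open>Extended potential cause graph and extended loop graph\<close>

text \<open>
  A labelled graph is a pair of a node set and a set of arrows; \<open>(a, T, b)\<close> is the arrow
  from \<open>a\<close> to \<open>b\<close> with label \<open>T\<close>.
\<close>

type_synonym 'v labelled_graph = "'v set \<times> ('v \<times> 'v set \<times> 'v) set"

text \<open>\<open>R\<close> is the set of those relations in \<open>A\<close> that are known to be irreducible.\<close>

inductive_set potential_cause_arrows ::
  "'v affects_rel set \<Rightarrow> 'v affects_rel set \<Rightarrow> 'v affects_rel set \<Rightarrow> ('v \<times> 'v set \<times> 'v) set"
  for A R B :: "'v affects_rel set" where
  irreducible: "\<lbrakk>Rel X Y1 Z Y2 \<in> A; Rel X Y1 Z Y2 \<in> R; a \<in> X; b \<in> Y1 \<union> Y2\<rbrakk> \<Longrightarrow>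
     (a, Y1 \<union> Y2, b) \<in> potential_cause_arrows A R B"
| absent: "\<lbrakk>Rel X Y1 Z Y2 \<in> A; a \<in> Z; Rel X Y1 (Z - {a}) Y2 \<in> B; b \<in> Y1 \<union> Y2\<rbrakk> \<Longrightarrow>
     (a, Y1 \<union> Y2, b) \<in> potential_cause_arrows A R B"

definition extended_potential_cause_graph ::
  "'v set \<Rightarrow> 'v affects_rel set \<Rightarrow> 'v affects_rel set \<Rightarrow> 'v affects_rel set \<Rightarrow> 'v labelled_graph" where
  "extended_potential_cause_graph S A R B = (S, potential_cause_arrows A R B)"

text \<open>
  Removing a childless node \<open>y\<close> removes every arrow \<open>(x, T, w)\<close> for which
  \<open>(x, T, y)\<close> is an arrow: for \<open>w = y\<close> these are the arrows into \<open>y\<close>,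
  and for \<open>w \<noteq> y\<close> the further arrows from \<open>x\<close> with the same label.
  Removing parentless nodes is permitted but, unlike removing childless ones, never required.
\<close>

inductive prune :: "'v labelled_graph \<Rightarrow> 'v labelled_graph \<Rightarrow> bool" where
  childless: "\<lbrakk>y \<in> N; \<And>T w. (y, T, w) \<notin> F\<rbrakk> \<Longrightarrow>
     prune (N, F) (N - {y}, {(x, T, w) \<in> F. (x, T, y) \<notin> F})"
| parentless: "\<lbrakk>x \<in> N; \<And>T w. (w, T, x) \<notin> F\<rbrakk> \<Longrightarrow>
     prune (N, F) (N - {x}, {(w, T, y) \<in> F. w \<noteq> x})"

definition extended_loop_graph :: "'v labelled_graph \<Rightarrow> 'v labelled_graph \<Rightarrow> bool" where
  "extended_loop_graph H L \<longleftrightarrow>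
     prune\<^sup>*\<^sup>* H L \<and> (\<forall>x \<in> fst L. \<exists>T y. (x, T, y) \<in> snd L)"

end

theory Submission
  imports Defs
begin

text \<open>
  The intervention node of \<open>a\<close> can only be connected to \<open>T\<close> through a directed
  path or through a collider below \<open>a\<close>. In the model post-intervention on \<open>Z\<close>, conditioning
  on \<open>Z\<close> opens no such collider, since the nodes of \<open>Z\<close> have lost their other parents.
  So if \<open>a\<close> is not an ancestor of \<open>T\<close>, intervening on \<open>a\<close>, besides \<open>Z\<close>,
  leaves the distribution of \<open>T\<close> unchanged. With \<open>T = Y \<union> W\<close> this shows that the
  source of each arrow labelled \<open>T\<close> is an ancestor of some element of \<open>T\<close>. Pruning
  keeps or removes all the arrows with a given source and label together, so every node of the extended
  loop graph has a proper descendant in it; as there are finitely many, there is a directed cycle.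
\<close>

section \<open>Conditional probabilities and events of observed values\<close>

lemma prob_cond_pmf:
  assumes "measure_pmf.prob P C > 0"
  shows "measure_pmf.prob (cond_pmf P C) B = measure_pmf.prob P (C \<inter> B) / measure_pmf.prob P C"
proof -
  have ne: "set_pmf P \<inter> C \<noteq> {}"
    using assms measure_pmf_zero_iff[of P C] by auto
  show ?thesis
    unfolding cond_pmf.rep_eq[OF ne]
    using assms by (intro measure_uniform_measure) (auto simp: measure_pmf.emeasure_eq_measure)
qed

lemma obs_event_Int: "obs_event X s \<inter> obs_event Y s = obs_event (X \<union> Y) s"
  by (auto simp: obs_event_def)

lemma obs_event_mono: "Y \<subseteq> X \<Longrightarrow> obs_event X s \<subseteq> obs_event Y s"
  by (auto simp: obs_event_def)

lemma prob_marginal: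
  fixes P :: "(('v, 'u) node \<Rightarrow> 'a val) pmf"
  assumes "T \<subseteq> X"
  shows "measure_pmf.prob (marginal X P) (obs_event T s) = measure_pmf.prob P (obs_event T s)"
proof -
  have "(\<lambda>\<omega>. restrict \<omega> (Obs ` X)) -` obs_event T s = (obs_event T s :: (('v, 'u) node \<Rightarrow> 'a val) set)"
    using assms by (auto simp: obs_event_def)
  then show ?thesis by (simp add: marginal_def)
qed

section \<open>d-separation of an intervention node\<close>

text \<open>The walk starts at \<open>p ! 1\<close> because node 0 will be the intervention node and
  \<open>p ! 1\<close> the variable it acts on.\<close>

lemma path_all_forward:
  assumes "undirected_path E p d" "\<forall>i<k. d ! i" "Suc 0 \<le> j" "j \<le> k" "k \<le> length d"
  shows "(p ! 1, p ! j) \<in> E\<^sup>*"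
  using assms(3,4)
proof (induction j rule: dec_induct)
  case base
  show ?case by simp
next
  case (step j)
  then have "(p ! j, p ! Suc j) \<in> E"
    using assms unfolding undirected_path_def by (metis less_le_trans)
  with step show ?case by (auto intro: rtrancl_into_rtrancl)
qed

text \<open>All new edges start at intervention nodes, which have no parents, and only new edges
  enter \<open>Z\<close>. A directed walk from \<open>a\<close> can therefore take neither.\<close>

lemma (in causal_model) rtrancl_interv_graph:
  assumes "(Obs a, n) \<in> (interv_graph E Z X)\<^sup>*" "a \<notin> Z"
  shows "(Obs a, n) \<in> E\<^sup>* \<and> n \<notin> Obs ` Z \<and> n \<notin> range Interv"
  using assms(1)
proof (induction rule: rtrancl_induct)
  case base
  then show ?case using assms(2) by auto
next
  case (step m n)
  then have "(m, n) \<in> E" "n \<notin> Obs ` Z"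
    by (auto simp: interv_graph_def)
  then show ?case using step edges by (auto intro: rtrancl_into_rtrancl)
qed

lemma (in causal_model) d_separated_Interv:
  assumes "a \<notin> Z" "a \<notin> T" "\<And>t. t \<in> T \<Longrightarrow> (Obs a, Obs t) \<notin> E\<^sup>+"
  shows "d_separated (interv_graph E Z {a}) {Interv a} (Obs ` T) (Obs ` Z)"
  unfolding d_separated_def
proof (intro allI impI, elim conjE)
  fix p d
  let ?G = "interv_graph E Z {a}"
  assume path: "undirected_path ?G p d" and hd: "hd p \<in> {Interv a}" and last: "last p \<in> Obs ` T"
  have len: "length p = Suc (length d)"
    using path by (simp add: undirected_path_def)
  then have hd0: "p ! 0 = Interv a" and lastn: "last p = p ! length d"
    using hd by (metis hd_conv_nth length_0_conv nat.distinct(1) singletonD)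
      (metis diff_Suc_1 last_conv_nth len length_0_conv nat.distinct(1))
  have pos: "0 < length d"
    using hd0 lastn last by (cases "length d") auto
  have no_parent: "(m, Interv e) \<notin> ?G" for m e
    using edges by (auto simp: interv_graph_def)
  have edge0: "if d ! 0 then (p ! 0, p ! 1) \<in> ?G else (p ! 1, p ! 0) \<in> ?G"
    using path pos by (auto simp: undirected_path_def split: if_splits)
  with no_parent hd0 have d0: "d ! 0" by metis
  with edge0 hd0 have "(Interv a, p ! 1) \<in> ?G" by simp
  then have p1: "p ! 1 = Obs a"
    using edges by (auto simp: interv_graph_def)
  show "blocked ?G (Obs ` Z) p d"
  \<comment> \<open>A path with forward edges only would make an element of \<open>T\<close> a
    descendant of \<open>a\<close>; any other path contains a collider.\<close>
  proof (cases "\<forall>i<length d. d ! i")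
    case True
    have "(p ! 1, p ! length d) \<in> ?G\<^sup>*"
      by (rule path_all_forward[OF path True _ order_refl order_refl]) (rule Suc_leI[OF pos])
    then have reach: "(Obs a, last p) \<in> ?G\<^sup>*"
      unfolding p1 lastn .
    obtain t where t: "t \<in> T" "last p = Obs t"
      using last by auto
    have "(Obs a, Obs t) \<in> E\<^sup>*"
      using rtrancl_interv_graph[OF reach assms(1)] unfolding t(2) by (rule conjunct1)
    then have "t = a"
      using assms(3)[OF t(1)] by (auto dest: rtranclD)
    then show ?thesis
      using assms(2) t(1) by simp
  next
    case False
    \<comment> \<open>Edge 0 points forwards, so the first backward edge \<open>k\<close> has a
      forward edge before it and \<open>p ! k\<close> is a collider. It descends from
      \<open>a\<close>, hence so does all that it reaches, and none of this lies in
      \<open>Z\<close>. The collider of \<open>blocked\<close> is \<open>p ! Suc i\<close>, so the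
      witness is \<open>k - 1\<close>.\<close>
    define k where "k = (LEAST k. k < length d \<and> \<not> d ! k)"
    have k: "k < length d" "\<not> d ! k"
      using False LeastI_ex[of "\<lambda>k. k < length d \<and> \<not> d ! k"] unfolding k_def by auto
    have below: "\<forall>i<k. d ! i"
      using not_less_Least k(1) less_trans unfolding k_def by blast
    obtain i where i: "k = Suc i"
      using k d0 by (cases k) auto
    have "(p ! 1, p ! k) \<in> ?G\<^sup>*"
      by (rule path_all_forward[OF path below _ order_refl]) (use i k(1) in simp_all)
    then have "(Obs a, p ! k) \<in> ?G\<^sup>*"
      unfolding p1 .
    then have "(p ! k, z) \<notin> ?G\<^sup>*" if "z \<in> Obs ` Z" for z
      using rtrancl_interv_graph[OF rtrancl_trans assms(1)] that by blast
    then show ?thesis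
      unfolding blocked_def using below k unfolding i by (intro exI[of _ i]) simp
  qed
qed

section \<open>Invariance of interventional probabilities\<close>

context causal_model
begin

definition obs_prob :: "'v set \<Rightarrow> 'v set \<Rightarrow> ('v \<Rightarrow> 'a) \<Rightarrow> real" where
  "obs_prob Z T s = measure_pmf.prob (D Z {}) (obs_event T s)"

text \<open>This is the probability of \<open>T = s\<close> under \<open>do(Z = s)\<close>. In
  \<open>D Z {}\<close> the intervention nodes are random, so the value of \<open>Z\<close> has to
  be fixed by conditioning.\<close>

definition interv_prob :: "'v set \<Rightarrow> 'v set \<Rightarrow> ('v \<Rightarrow> 'a) \<Rightarrow> real" where
  "interv_prob Z T s = obs_prob Z (T \<union> Z) s / obs_prob Z Z s"

lemma observed_value:
  assumes "Z \<subseteq> S" "\<omega> \<in> set_pmf (D Z {})" "e \<in> S"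
  shows "\<omega> (Obs e) \<in> Val ` V e"
proof -
  have "set_pmf (D Z {}) \<subseteq> Pi\<^sub>E (observed_nodes S Z) (node_vals V)"
    using support[OF assms(1) empty_subsetI Int_empty_right] by simp
  then have "\<omega> \<in> Pi\<^sub>E (observed_nodes S Z) (node_vals V)"
    using assms(2) by (rule subsetD)
  then have "\<omega> (Obs e) \<in> node_vals V (Obs e :: ('v, 'u) node)"
    by (rule PiE_mem) (simp add: observed_nodes_def assms(3))
  then show ?thesis by simp
qed

lemma obs_prob_pos_admissible:
  assumes "Z \<subseteq> S" "T \<subseteq> S" "obs_prob Z T s > 0" "e \<in> T"
  shows "s e \<in> V e"
proof -
  obtain \<omega> where w: "\<omega> \<in> set_pmf (D Z {})" "\<omega> \<in> obs_event T s"
    using assms(3) measure_pmf_zero_iff[of "D Z {}" "obs_event T s"]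
    unfolding obs_prob_def by fastforce
  have "\<omega> (Obs e) \<in> Val ` V e"
    using observed_value[OF assms(1) w(1)] assms(2,4) by blast
  then show ?thesis using w(2) assms(4) by (auto simp: obs_event_def)
qed

text \<open>Setting \<open>Z\<close> to \<open>s\<close> by intervention has positive probability
  and forces \<open>Z = s\<close>.\<close>

lemma obs_prob_pos:
  assumes "Z \<subseteq> S" "\<And>e. e \<in> Z \<Longrightarrow> s e \<in> V e"
  shows "obs_prob Z Z s > 0"
proof -
  have "measure_pmf.prob (D Z {}) (do_event Z s) > 0"
    using post_do_pos[of "{}" Z s] assms by simp
  also have "measure_pmf.prob (D Z {}) (do_event Z s) \<le> obs_prob Z Z s"
    unfolding obs_prob_def
  \<comment> \<open>Forcing is only known on the support, so the inclusion of events holds almost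
    surely.\<close>
  proof (rule measure_pmf.finite_measure_mono_AE)
    show "AE \<omega> in measure_pmf (D Z {}). \<omega> \<in> do_event Z s \<longrightarrow> \<omega> \<in> obs_event Z s"
      using do_forces[of Z "{}"] assms(1)
      by (auto simp: AE_measure_pmf_iff do_event_def obs_event_def)
  qed simp
  finally show ?thesis .
qed

text \<open>Both sides are read off from the augmented model \<open>D Z {a}\<close>: conditioned on
  idle it gives the model of \<open>Z\<close>, conditioned on do the one of
  \<open>insert a Z\<close>. Given \<open>Z\<close>, the intervention node is independent of
  \<open>T\<close>, so the two conditions yield the same probability.\<close>

lemma interv_prob_insert:
  assumes Z: "insert a Z \<subseteq> S" "a \<notin> Z" and T: "T \<subseteq> S" "T \<inter> insert a Z = {}"
    and anc: "\<And>t. t \<in> T \<Longrightarrow> (Obs a, Obs t) \<notin> E\<^sup>+"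
    and adm: "\<And>e. e \<in> insert a Z \<Longrightarrow> s e \<in> V e"
  shows "interv_prob (insert a Z) T s = interv_prob Z T s"
proof -
  let ?Q = "D Z {a}"
  let ?q = "\<lambda>X A. measure_pmf.prob ?Q (A \<inter> obs_event X s)"
  have sub: "Z \<subseteq> S" "{a} \<subseteq> S" "Z \<inter> {a} = {}" "Z \<union> {a} = insert a Z"
    using Z by auto
  have adma: "\<And>e. e \<in> {a} \<Longrightarrow> s e \<in> V e"
    using adm by auto
  have posI: "measure_pmf.prob ?Q (idle_event {a}) > 0"
    using idle_pos sub by blast
  have posD: "measure_pmf.prob ?Q (do_event {a} s) > 0"
    by (rule do_pos[OF sub(1-3) adma])
  have posP: "obs_prob (insert a Z) {a} s > 0"
  proof -
    have "obs_prob (insert a Z) (insert a Z) s > 0"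
      using obs_prob_pos Z(1) adm by blast
    also have "obs_prob (insert a Z) (insert a Z) s \<le> obs_prob (insert a Z) {a} s"
      unfolding obs_prob_def by (intro measure_pmf.finite_measure_mono obs_event_mono) auto
    finally show ?thesis .
  qed
  \<comment> \<open>The factor in front of \<open>obs_prob\<close> does not depend on
    \<open>X\<close> and cancels later, here and in \<open>q_do\<close>.\<close>
  have q_idle: "?q X (idle_event {a}) = measure_pmf.prob ?Q (idle_event {a}) * obs_prob Z X s"
    if "X \<subseteq> S" for X
    using arg_cong[OF idle[OF sub(1-3)], of "\<lambda>P. measure_pmf.prob P (obs_event X s)"] posI that
    by (simp add: prob_marginal prob_cond_pmf obs_prob_def field_simps)
  \<comment> \<open>In the model of \<open>insert a Z\<close> the do condition becomes
    \<open>a = s a\<close>, whence \<open>insert a X\<close>.\<close>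
  have q_do: "?q X (do_event {a} s) = measure_pmf.prob ?Q (do_event {a} s)
      / obs_prob (insert a Z) {a} s * obs_prob (insert a Z) (insert a X) s"
    if "X \<subseteq> S" for X
  proof -
    have "marginal S (cond_pmf ?Q (do_event {a} s))
        = marginal S (cond_pmf (D (insert a Z) {}) (obs_event {a} s))"
      using augmented_do[OF sub(1-3) adma] post_do[OF sub(1-3) adma] sub(4) by simp
    from arg_cong[OF this, of "\<lambda>P. measure_pmf.prob P (obs_event X s)"] show ?thesis
      using posD posP that
      by (simp add: prob_marginal prob_cond_pmf obs_prob_def obs_event_Int field_simps)
  qed
  \<comment> \<open>Independence is only available given an event of positive probability;
    \<open>Z = s\<close> already occurs while \<open>a\<close> is idle.\<close>
  have qZ: "measure_pmf.prob ?Q (obs_event Z s) > 0"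
  proof -
    have "?q Z (idle_event {a}) > 0"
      using q_idle[of Z] posI obs_prob_pos[of Z s] sub(1) adm by simp
    then show ?thesis
      by (rule less_le_trans) (intro measure_pmf.finite_measure_mono, auto)
  qed
  have indep: "cond_indep ?Q {Interv a} (Obs ` T) (Obs ` Z)"
  proof -
    have "d_separated (interv_graph E Z {a}) {Interv a} (Obs ` T) (Obs ` Z)"
      by (rule d_separated_Interv) (use Z T anc in auto)
    then show ?thesis
      by (intro compatible[OF sub(1-3), unfolded compatible_def, rule_format] conjI)
        (use Z T in \<open>auto simp: observed_nodes_def\<close>)
  qed
  \<comment> \<open>Conditional independence with denominators cleared, for any value
    \<open>c\<close> of the intervention node, to be used with \<open>Do (s a)\<close> and
    \<open>Idle\<close>.\<close>
  have prod: "?q (T \<union> Z) C * measure_pmf.prob ?Q (obs_event Z s)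
      = ?q Z C * measure_pmf.prob ?Q (obs_event (T \<union> Z) s)"
    if C: "C = {\<omega>. \<omega> (Interv a) = c}" for C c
  proof -
    \<comment> \<open>\<open>cond_indep\<close> takes one assignment of all nodes; outside the
      observed variables only the value at \<open>Interv a\<close> matters.\<close>
    define r where "r n = (case n of Obs e \<Rightarrow> Val (s e) | _ \<Rightarrow> c)" for n :: "('v, 'u) node"
    have r: "agree (Obs ` X) r = obs_event X s" "agree {Interv a} r = C" for X
      by (auto simp: agree_def obs_event_def r_def C)
    have rU: "agree ({Interv a} \<union> Obs ` T) r = C \<inter> obs_event T s"
      by (auto simp: agree_def obs_event_def r_def C)
    have "measure_pmf.prob (cond_pmf ?Q (obs_event Z s)) (C \<inter> obs_event T s)
        = measure_pmf.prob (cond_pmf ?Q (obs_event Z s)) C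
        * measure_pmf.prob (cond_pmf ?Q (obs_event Z s)) (obs_event T s)"
      using indep[unfolded cond_indep_def, rule_format, of r] qZ unfolding r rU .
    moreover have "obs_event Z s \<inter> (C \<inter> obs_event T s) = C \<inter> obs_event (T \<union> Z) s"
      "obs_event Z s \<inter> C = C \<inter> obs_event Z s"
      "obs_event Z s \<inter> obs_event T s = (obs_event (T \<union> Z) s :: (('v, 'u) node \<Rightarrow> 'a val) set)"
      by (auto simp: obs_event_def)
    ultimately show ?thesis
      using qZ by (simp add: prob_cond_pmf field_simps)
  qed
  have cancel: "x * u = y * v" if "c * x * u = c * y * v" "c > 0" for c x y u v :: real
    using that by simp
  have TZ: "T \<union> Z \<subseteq> S"
    using T(1) sub(1) by simp
  \<comment> \<open>This equation and its idle counterpart share their augmented probabilities, so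
    both sides of the goal equal the conditional probability of \<open>T = s\<close> given
    \<open>Z = s\<close> under \<open>?Q\<close>.\<close>
  have "obs_prob (insert a Z) (insert a (T \<union> Z)) s * measure_pmf.prob ?Q (obs_event Z s)
      = obs_prob (insert a Z) (insert a Z) s * measure_pmf.prob ?Q (obs_event (T \<union> Z) s)"
  proof (rule cancel)
    have "do_event {a} s = {\<omega>. \<omega> (Interv a) = Do (s a)}"
      by (simp add: do_event_def)
    from prod[OF this] show "measure_pmf.prob ?Q (do_event {a} s) / obs_prob (insert a Z) {a} s
        * obs_prob (insert a Z) (insert a (T \<union> Z)) s * measure_pmf.prob ?Q (obs_event Z s)
      = measure_pmf.prob ?Q (do_event {a} s) / obs_prob (insert a Z) {a} s
        * obs_prob (insert a Z) (insert a Z) s * measure_pmf.prob ?Q (obs_event (T \<union> Z) s)"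
      unfolding q_do[OF TZ] q_do[OF sub(1)] .
    show "measure_pmf.prob ?Q (do_event {a} s) / obs_prob (insert a Z) {a} s > 0"
      using posD posP by simp
  qed
  moreover have "obs_prob Z (T \<union> Z) s * measure_pmf.prob ?Q (obs_event Z s)
      = obs_prob Z Z s * measure_pmf.prob ?Q (obs_event (T \<union> Z) s)"
  proof (rule cancel)
    have "idle_event {a} = {\<omega>. \<omega> (Interv a) = Idle}"
      by (simp add: idle_event_def)
    from prod[OF this] show "measure_pmf.prob ?Q (idle_event {a})
        * obs_prob Z (T \<union> Z) s * measure_pmf.prob ?Q (obs_event Z s)
      = measure_pmf.prob ?Q (idle_event {a})
        * obs_prob Z Z s * measure_pmf.prob ?Q (obs_event (T \<union> Z) s)"
      unfolding q_idle[OF TZ] q_idle[OF sub(1)] .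
  qed (fact posI)
  moreover have "obs_prob (insert a Z) (insert a Z) s > 0"
    by (rule obs_prob_pos[OF Z(1) adm])
  moreover have "obs_prob Z Z s > 0"
    using obs_prob_pos[OF sub(1)] adm by simp
  moreover have "x / y = v / u" if "x * u = y * v" "y > 0" "u > 0" for x y u v :: real
    using that by (simp add: field_simps)
  ultimately show ?thesis
    using qZ unfolding interv_prob_def Un_insert_right by metis
qed

section \<open>Affects relations in terms of interventional probabilities\<close>

text \<open>A \<open>pmf\<close> is determined by its point masses, and each point mass of a
  marginal is either the probability of some \<open>obs_event\<close> or zero, since observed nodes
  only take values of the form \<open>Val\<close>.\<close>

lemma marginal_neq_iff:
  assumes "Y \<subseteq> S" "Z \<subseteq> S" "Z' \<subseteq> S"
    and pos: "measure_pmf.prob (D Z {}) C > 0" "measure_pmf.prob (D Z' {}) C' > 0"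
  shows "marginal Y (cond_pmf (D Z {}) C) \<noteq> marginal Y (cond_pmf (D Z' {}) C') \<longleftrightarrow>
    (\<exists>y. measure_pmf.prob (cond_pmf (D Z {}) C) (obs_event Y y) \<noteq>
         measure_pmf.prob (cond_pmf (D Z' {}) C') (obs_event Y y))"
    (is "?M \<noteq> ?M' \<longleftrightarrow> (\<exists>y. ?P y \<noteq> ?P' y)")
proof
  assume "\<exists>y. ?P y \<noteq> ?P' y"
  then obtain y where "?P y \<noteq> ?P' y" ..
  then have "measure_pmf.prob ?M (obs_event Y y) \<noteq> measure_pmf.prob ?M' (obs_event Y y)"
    by (simp add: prob_marginal)
  then show "?M \<noteq> ?M'" by auto
next
  \<comment> \<open>\<open>obs_val\<close> singles out the outcomes with proper values on
    \<open>Y\<close>, and \<open>obs_of\<close> reads these values. The defaults \<open>Idle\<close>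
    and \<open>undefined\<close> never matter: the restriction erases the former, and the latter is
    not met on \<open>Y\<close>.\<close>
  define obs_val where "obs_val f \<longleftrightarrow>
      (\<exists>y. f = restrict (\<lambda>n. case n of Obs e \<Rightarrow> Val (y e) | _ \<Rightarrow> Idle) (Obs ` Y))"
    for f :: "('v, 'u) node \<Rightarrow> 'a val"
  define obs_of where "obs_of f e = (case f (Obs e) of Val v \<Rightarrow> v | _ \<Rightarrow> undefined)"
    for f :: "('v, 'u) node \<Rightarrow> 'a val" and e
  have pmf_marginal: "pmf (marginal Y (cond_pmf (D Z {}) C)) f
      = (if obs_val f then measure_pmf.prob (cond_pmf (D Z {}) C) (obs_event Y (obs_of f)) else 0)"
    if Z: "Z \<subseteq> S" and pos: "measure_pmf.prob (D Z {}) C > 0" for Z C f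
  proof (cases "obs_val f")
    case True
    then obtain y where f: "f = restrict (\<lambda>n. case n of Obs e \<Rightarrow> Val (y e) | _ \<Rightarrow> Idle) (Obs ` Y)"
      unfolding obs_val_def by blast
    have "obs_of f e = y e" if "e \<in> Y" for e
      using that by (simp add: obs_of_def f)
    moreover have "restrict \<omega> (Obs ` Y) = f \<longleftrightarrow> (\<forall>e\<in>Y. \<omega> (Obs e) = Val (y e))" for \<omega>
    proof
      assume "restrict \<omega> (Obs ` Y) = f"
      then have "restrict \<omega> (Obs ` Y) (Obs e) = f (Obs e)" for e
        by simp
      then show "\<forall>e\<in>Y. \<omega> (Obs e) = Val (y e)"
        unfolding f by (metis (mono_tags, lifting) imageI node.simps(10) restrict_apply')
    next
      assume "\<forall>e\<in>Y. \<omega> (Obs e) = Val (y e)"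
      then show "restrict \<omega> (Obs ` Y) = f"
        unfolding f by (intro restrict_ext) auto
    qed
    ultimately have "(\<lambda>\<omega>. restrict \<omega> (Obs ` Y)) -` {f} = obs_event Y (obs_of f)"
      by (simp add: obs_event_def vimage_def)
    with True show ?thesis
      by (simp add: marginal_def pmf_map)
  next
    case False
    have "f \<notin> set_pmf (marginal Y (cond_pmf (D Z {}) C))"
    proof
      assume "f \<in> set_pmf (marginal Y (cond_pmf (D Z {}) C))"
      then obtain \<omega> where w: "\<omega> \<in> set_pmf (D Z {})" "f = restrict \<omega> (Obs ` Y)"
        using set_cond_pmf[of "D Z {}" C] pos measure_pmf_zero_iff[of "D Z {}" C]
        by (auto simp: marginal_def)
      have "\<omega> (Obs e) \<in> Val ` V e" if "e \<in> Y" for e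
        using observed_value[OF Z w(1)] assms(1) that by blast
      then have "\<exists>y. \<forall>e\<in>Y. \<omega> (Obs e) = Val (y e)"
        by (intro bchoice) blast
      then obtain y where "\<forall>e\<in>Y. \<omega> (Obs e) = Val (y e)" ..
      then have "f = restrict (\<lambda>n. case n of Obs e \<Rightarrow> Val (y e) | _ \<Rightarrow> Idle) (Obs ` Y)"
        unfolding w(2) by (intro restrict_ext) auto
      with False show False unfolding obs_val_def by blast
    qed
    with False show ?thesis by (simp add: set_pmf_iff)
  qed
  assume "?M \<noteq> ?M'"
  then obtain f where "pmf ?M f \<noteq> pmf ?M' f"
    unfolding pmf_eq_iff not_all ..
  then have "?P (obs_of f) \<noteq> ?P' (obs_of f)"
    unfolding pmf_marginal[OF assms(2) pos(1)] pmf_marginal[OF assms(3) pos(2)]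
    by (cases "obs_val f") simp_all
  then show "\<exists>y. ?P y \<noteq> ?P' y"
    by (rule exI[of _ "obs_of f"])
qed

text \<open>\<open>interv_prob_insert\<close> has no conditioning on \<open>W\<close>, so
  conditional probabilities are written as ratios of probabilities of \<open>Y \<union> W\<close>
  and \<open>W\<close>. Positivity of the conditions makes the values on \<open>X \<union> Z\<close>
  admissible, as that lemma requires.\<close>

lemma affects_iff:
  assumes "rel_over S (Rel X Y Z W)"
  shows "affects D (Rel X Y Z W) \<longleftrightarrow>
    (\<exists>s. (\<forall>e \<in> X \<union> Z. s e \<in> V e) \<and>
         interv_prob (X \<union> Z) W s > 0 \<and> interv_prob Z W s > 0 \<and>
         interv_prob (X \<union> Z) (Y \<union> W) s / interv_prob (X \<union> Z) W s \<noteq>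
         interv_prob Z (Y \<union> W) s / interv_prob Z W s)"
proof -
  have sub: "X \<subseteq> S" "Y \<subseteq> S" "Z \<subseteq> S" "W \<subseteq> S" "Y \<inter> (X \<union> Z \<union> W) = {}"
    using assms by auto
  have "affects D (Rel X Y Z W) \<longleftrightarrow>
    (\<exists>s y. obs_prob (X \<union> Z) (X \<union> Z \<union> W) s > 0 \<and> obs_prob Z (Z \<union> W) s > 0 \<and>
       measure_pmf.prob (D (X \<union> Z) {}) (obs_event (X \<union> Z \<union> W) s \<inter> obs_event Y y)
         / obs_prob (X \<union> Z) (X \<union> Z \<union> W) s \<noteq>
       measure_pmf.prob (D Z {}) (obs_event (Z \<union> W) s \<inter> obs_event Y y) / obs_prob Z (Z \<union> W) s)"
  proof -
    have "marginal Y (cond_pmf (D (X \<union> Z) {}) (obs_event (X \<union> Z \<union> W) s)) \<noteq>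
          marginal Y (cond_pmf (D Z {}) (obs_event (Z \<union> W) s)) \<longleftrightarrow>
      (\<exists>y. measure_pmf.prob (D (X \<union> Z) {}) (obs_event (X \<union> Z \<union> W) s \<inter> obs_event Y y)
         / obs_prob (X \<union> Z) (X \<union> Z \<union> W) s \<noteq>
       measure_pmf.prob (D Z {}) (obs_event (Z \<union> W) s \<inter> obs_event Y y) / obs_prob Z (Z \<union> W) s)"
      if "obs_prob (X \<union> Z) (X \<union> Z \<union> W) s > 0" "obs_prob Z (Z \<union> W) s > 0" for s
      using marginal_neq_iff[of Y "X \<union> Z" Z] that sub by (simp add: obs_prob_def prob_cond_pmf)
    then show ?thesis
      unfolding affects.simps obs_prob_def[symmetric] by blast
  qed
  also have "\<dots> \<longleftrightarrow>
    (\<exists>s. obs_prob (X \<union> Z) (X \<union> Z \<union> W) s > 0 \<and> obs_prob Z (Z \<union> W) s > 0 \<and>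
       obs_prob (X \<union> Z) (X \<union> Z \<union> W \<union> Y) s / obs_prob (X \<union> Z) (X \<union> Z \<union> W) s \<noteq>
       obs_prob Z (Z \<union> W \<union> Y) s / obs_prob Z (Z \<union> W) s)" (is "(\<exists>s y. ?l s y) \<longleftrightarrow> (\<exists>s. ?r s)")
  proof
    assume "\<exists>s y. ?l s y"
    then obtain s y where l: "?l s y" by blast
    \<comment> \<open>One assignment can supply all values because \<open>Y\<close> is disjoint from
      the conditioning sets.\<close>
    define t where "t = override_on s y Y"
    have t: "obs_event (X \<union> Z \<union> W) t = (obs_event (X \<union> Z \<union> W) s :: (('v, 'u) node \<Rightarrow> 'a val) set)"
      "obs_event (Z \<union> W) t = (obs_event (Z \<union> W) s :: (('v, 'u) node \<Rightarrow> 'a val) set)"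
      "obs_event Y t = (obs_event Y y :: (('v, 'u) node \<Rightarrow> 'a val) set)"
      using sub(5) by (auto simp: obs_event_def t_def override_on_def)
    have "?r t"
      using l unfolding obs_prob_def obs_event_Int[of _ _ Y, symmetric] t .
    then show "\<exists>s. ?r s" by blast
  next
    assume "\<exists>s. ?r s"
    then obtain s where "?r s" by blast
    then have "?l s s"
      by (simp add: obs_event_Int obs_prob_def)
    then show "\<exists>s y. ?l s y" by blast
  qed
  also have "\<dots> \<longleftrightarrow> (\<exists>s. (\<forall>e \<in> X \<union> Z. s e \<in> V e) \<and> ?r s)"
  proof -
    have "\<forall>e \<in> X \<union> Z. s e \<in> V e" if "?r s" for s
      using obs_prob_pos_admissible[of "X \<union> Z" "X \<union> Z \<union> W" s] that sub by blast
    then show ?thesis by blast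
  qed
  also have "\<dots> \<longleftrightarrow> (\<exists>s. (\<forall>e \<in> X \<union> Z. s e \<in> V e) \<and>
         interv_prob (X \<union> Z) W s > 0 \<and> interv_prob Z W s > 0 \<and>
         interv_prob (X \<union> Z) (Y \<union> W) s / interv_prob (X \<union> Z) W s \<noteq>
         interv_prob Z (Y \<union> W) s / interv_prob Z W s)"
  \<comment> \<open>For admissible values the denominators inside \<open>interv_prob\<close> are
    positive, and they cancel in the ratios.\<close>
  proof (rule ex_cong1, rule conj_cong[OF refl])
    fix s
    assume "\<forall>e \<in> X \<union> Z. s e \<in> V e"
    then have pos: "obs_prob (X \<union> Z) (X \<union> Z) s > 0" "obs_prob Z Z s > 0"
      using obs_prob_pos[of "X \<union> Z" s] obs_prob_pos[of Z s] sub by auto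
    have sets: "X \<union> Z \<union> W = W \<union> (X \<union> Z)" "W \<union> (X \<union> Z) \<union> Y = Y \<union> W \<union> (X \<union> Z)"
      "Z \<union> W = W \<union> Z" "W \<union> Z \<union> Y = Y \<union> W \<union> Z"
      by auto
    show "?r s \<longleftrightarrow> interv_prob (X \<union> Z) W s > 0 \<and> interv_prob Z W s > 0 \<and>
         interv_prob (X \<union> Z) (Y \<union> W) s / interv_prob (X \<union> Z) W s \<noteq>
         interv_prob Z (Y \<union> W) s / interv_prob Z W s"
      using pos unfolding sets interv_prob_def by (simp add: zero_less_divide_iff)
  qed
  finally show ?thesis .
qed

section \<open>Ancestors from affects relations\<close>

text \<open>Both numerator and denominator must be invariant under the intervention, so the
  descendant may lie in \<open>W\<close> as well as in \<open>Y\<close>.\<close>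

lemma affects_singleton_ancestor:
  assumes "rel_over S (Rel {a} Y Z W)" "affects D (Rel {a} Y Z W)"
  shows "\<exists>b \<in> Y \<union> W. (Obs a, Obs b) \<in> E\<^sup>+"
proof (rule ccontr)
  assume none: "\<not> ?thesis"
  obtain s where s: "\<forall>e \<in> {a} \<union> Z. s e \<in> V e"
    and neq: "interv_prob ({a} \<union> Z) (Y \<union> W) s / interv_prob ({a} \<union> Z) W s \<noteq>
      interv_prob Z (Y \<union> W) s / interv_prob Z W s"
    using assms(2) unfolding affects_iff[OF assms(1)] by blast
  have "interv_prob (insert a Z) T s = interv_prob Z T s" if "T \<subseteq> Y \<union> W" for T
    using that assms(1) none s by (intro interv_prob_insert) auto
  from this[of W] this[of "Y \<union> W"] neq show False by simp
qed

text \<open>Irreducibility for the subset \<open>{a}\<close> moves the rest of \<open>X\<close> into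
  the do set and leaves a relation with source \<open>{a}\<close>. It concerns proper subsets only;
  for \<open>X = {a}\<close> the relation itself is of this form.\<close>

lemma irreducible_ancestor:
  assumes "rel_over S (Rel X Y Z W)" "affects D (Rel X Y Z W)" "\<not> reducible D (Rel X Y Z W)"
    and "a \<in> X"
  shows "\<exists>b \<in> Y \<union> W. (Obs a, Obs b) \<in> E\<^sup>+"
proof (rule affects_singleton_ancestor)
  show "rel_over S (Rel {a} Y (Z \<union> (X - {a})) W)"
    using assms(1,4) by auto
  show "affects D (Rel {a} Y (Z \<union> (X - {a})) W)"
  proof (cases "X = {a}")
    case True
    then show ?thesis using assms(2) by simp
  next
    case False
    with assms(4) have "{a} \<noteq> {}" "{a} \<subset> X" by auto
    with assms(3) show ?thesis unfolding reducible.simps by blast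
  qed
qed

text \<open>If \<open>a\<close> had no descendant in \<open>Y \<union> W\<close>, dropping it from
  both do sets, \<open>Z\<close> and \<open>X \<union> Z\<close>, would change none of the four
  probabilities, and the relation known to be absent would hold.\<close>

lemma absent_ancestor:
  assumes "rel_over S (Rel X Y Z W)" "affects D (Rel X Y Z W)"
    and "a \<in> Z" "\<not> affects D (Rel X Y (Z - {a}) W)"
  shows "\<exists>b \<in> Y \<union> W. (Obs a, Obs b) \<in> E\<^sup>+"
proof (rule ccontr)
  assume none: "\<not> ?thesis"
  have over: "rel_over S (Rel X Y (Z - {a}) W)"
    using assms(1) by auto
  have sub: "Z \<subseteq> S" "X \<subseteq> S" "Y \<union> W \<subseteq> S" "a \<notin> X" "(Y \<union> W) \<inter> (X \<union> Z) = {}"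
    using assms(1,3) by auto
  obtain s where s: "\<forall>e \<in> X \<union> Z. s e \<in> V e"
    and pos: "interv_prob (X \<union> Z) W s > 0" "interv_prob Z W s > 0"
    and neq: "interv_prob (X \<union> Z) (Y \<union> W) s / interv_prob (X \<union> Z) W s \<noteq>
      interv_prob Z (Y \<union> W) s / interv_prob Z W s"
    using assms(2) unfolding affects_iff[OF assms(1)] by blast
  have eq: "interv_prob Z T s = interv_prob (Z - {a}) T s"
    "interv_prob (X \<union> Z) T s = interv_prob (X \<union> (Z - {a})) T s"
    if "T \<subseteq> Y \<union> W" for T
  proof -
    have sets: "insert a (Z - {a}) = Z" "insert a (X \<union> (Z - {a})) = X \<union> Z"
      using assms(3) by auto
    have T: "T \<subseteq> S" "T \<inter> Z = {}" "T \<inter> (X \<union> Z) = {}"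
      using that sub by blast+
    have anc: "(Obs a, Obs t) \<notin> E\<^sup>+" if "t \<in> T" for t
      using none that \<open>T \<subseteq> Y \<union> W\<close> by blast
    have "interv_prob (insert a (Z - {a})) T s = interv_prob (Z - {a}) T s"
    proof (rule interv_prob_insert, unfold sets)
      show "s e \<in> V e" if "e \<in> Z" for e
        using s that by blast
    qed (use sub T anc in simp_all)
    moreover have "interv_prob (insert a (X \<union> (Z - {a}))) T s = interv_prob (X \<union> (Z - {a})) T s"
    proof (rule interv_prob_insert, unfold sets)
      show "s e \<in> V e" if "e \<in> X \<union> Z" for e
        using s that by blast
    qed (use sub T anc in simp_all)
    ultimately show "interv_prob Z T s = interv_prob (Z - {a}) T s"
      "interv_prob (X \<union> Z) T s = interv_prob (X \<union> (Z - {a})) T s"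
      unfolding sets .
  qed
  have "\<forall>e \<in> X \<union> (Z - {a}). s e \<in> V e"
    using s by blast
  with pos neq have "affects D (Rel X Y (Z - {a}) W)"
    unfolding affects_iff[OF over] eq[OF Un_upper2] eq[OF order_refl] by blast
  with assms(4) show False by contradiction
qed

end

section \<open>Arrows, pruning and the directed cycle\<close>

text \<open>The target \<open>b\<close> itself need not descend from \<open>a\<close>; only some
  element of the label does, which is why arrows with a common source and label must be treated
  together.\<close>

lemma potential_cause_arrow_ancestor:
  assumes "causal_model S U E V D"
    and "\<forall>r \<in> A. rel_over S r" "\<forall>r \<in> A. affects D r" "\<forall>r \<in> R. \<not> reducible D r"
    and "\<forall>r \<in> B. \<not> affects D r"
    and "(a, T, b) \<in> potential_cause_arrows A R B"
  shows "\<exists>b' \<in> T. (Obs a, Obs b') \<in> E\<^sup>+ \<and> (a, T, b') \<in> potential_cause_arrows A R B"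
  using assms(6)
proof cases
  case (irreducible X Y1 Z Y2)
  then show ?thesis
    using causal_model.irreducible_ancestor[OF assms(1), of X Y1 Z Y2 a] assms
      potential_cause_arrows.irreducible[of X Y1 Z Y2 A R a] by blast
next
  case (absent X Y1 Z Y2)
  then show ?thesis
    using causal_model.absent_ancestor[OF assms(1), of X Y1 Z Y2 a] assms
      potential_cause_arrows.absent[of X Y1 Z Y2 A a] by blast
qed

lemma potential_cause_arrows_closed:
  assumes "(a, T, b) \<in> potential_cause_arrows A R B" "b' \<in> T"
  shows "(a, T, b') \<in> potential_cause_arrows A R B"
  using assms by (auto elim!: potential_cause_arrows.cases intro: potential_cause_arrows.intros)

lemma potential_cause_arrows_nodes:
  assumes "\<forall>r \<in> A. rel_over S r" "(a, T, b) \<in> potential_cause_arrows A R B"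
  shows "a \<in> S \<and> b \<in> T \<and> T \<subseteq> S"
  using assms(2,1) by cases force+

text \<open>If a removed node lay in the label of a surviving arrow, closure would supply an arrow
  with the same source and label into that node. For a childless node the survivor would then have
  been removed too; for a parentless node no such arrow exists.\<close>

lemma prune_invariant:
  assumes "prune\<^sup>*\<^sup>* H L" "\<And>a T b. (a, T, b) \<in> snd H \<Longrightarrow> b \<in> T \<and> T \<subseteq> fst H"
    and "\<And>a T b b'. (a, T, b) \<in> snd H \<Longrightarrow> b' \<in> T \<Longrightarrow> (a, T, b') \<in> snd H"
  shows "fst L \<subseteq> fst H \<and> snd L \<subseteq> snd H \<and> (\<forall>a T b. (a, T, b) \<in> snd L \<longrightarrow>
    b \<in> T \<and> T \<subseteq> fst L \<and> (\<forall>b' \<in> T. (a, T, b') \<in> snd L))"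
  using assms(1)
proof (induction rule: rtranclp_induct)
  case base
  then show ?case using assms(2,3) by blast
next
  case (step L L')
  from step(2) show ?case
  proof cases
    case (childless y N F)
    then show ?thesis using step.IH by simp blast
  next
    case (parentless x N F)
    then show ?thesis using step.IH by simp blast
  qed
qed

text \<open>Otherwise the finite set \<open>N\<close> would have a maximal element. Restricting
  \<open>r\<^sup>+\<close> instead of \<open>r\<close> allows the connecting paths to leave
  \<open>N\<close>, for instance through infinitely many hidden nodes.\<close>

lemma not_acyclic_if_successors:
  assumes "finite N" "N \<noteq> {}" "\<And>x. x \<in> N \<Longrightarrow> \<exists>y \<in> N. (x, y) \<in> r\<^sup>+"
  shows "\<not> acyclic r"
proof
  assume "acyclic r"
  then have "acyclic (r\<^sup>+ \<inter> N \<times> N)"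
    unfolding acyclic_def by (metis inf_le1 trancl_id trancl_mono trans_trancl)
  then have "wf ((r\<^sup>+ \<inter> N \<times> N)\<inverse>)"
    using assms(1) by (intro finite_acyclic_wf_converse) auto
  then obtain x where "x \<in> N" "\<And>y. (y, x) \<in> (r\<^sup>+ \<inter> N \<times> N)\<inverse> \<Longrightarrow> y \<notin> N"
    using assms(2) by (metis ex_in_conv wfE_min)
  then show False using assms(3)[of x] by blast
qed

theorem theorem3p25:
  fixes S :: "'v set"
    and A R B :: "'v affects_rel set"
    and L :: "'v labelled_graph"
    and U :: "'u set"
    and E :: "(('v, 'u) node \<times> ('v, 'u) node) set"
    and V :: "'v \<Rightarrow> 'a set"
    and D :: "'v set \<Rightarrow> 'v set \<Rightarrow> (('v, 'u) node \<Rightarrow> 'a val) pmf"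
  assumes "finite S"
    and "\<forall>r \<in> A. rel_over S r"
    and "R \<subseteq> A"
    and "\<forall>r \<in> B. rel_over S r"
    and "extended_loop_graph (extended_potential_cause_graph S A R B) L"
    and "fst L \<noteq> {}"
    and "causal_model S U E V D"
    and "\<forall>r \<in> A. affects D r"
    and "\<forall>r \<in> R. \<not> reducible D r"
    and "\<forall>r \<in> B. \<not> affects D r"
  shows "\<not> acyclic E"
proof -
  let ?F = "potential_cause_arrows A R B"
  have "prune\<^sup>*\<^sup>* (S, ?F) L"
    and child: "\<And>x. x \<in> fst L \<Longrightarrow> \<exists>T y. (x, T, y) \<in> snd L"
    using assms(5) by (auto simp: extended_loop_graph_def extended_potential_cause_graph_def)
  have pruned: "fst L \<subseteq> fst (S, ?F) \<and> snd L \<subseteq> snd (S, ?F) \<and> (\<forall>a T b. (a, T, b) \<in> snd L \<longrightarrow>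
    b \<in> T \<and> T \<subseteq> fst L \<and> (\<forall>b' \<in> T. (a, T, b') \<in> snd L))"
  proof (rule prune_invariant)
    show "prune\<^sup>*\<^sup>* (S, ?F) L" by fact
  next
    fix a T b
    assume "(a, T, b) \<in> snd (S, ?F)"
    then show "b \<in> T \<and> T \<subseteq> fst (S, ?F)"
      using potential_cause_arrows_nodes[OF assms(2)] by simp
  next
    fix a T b b'
    assume "(a, T, b) \<in> snd (S, ?F)" "b' \<in> T"
    then show "(a, T, b') \<in> snd (S, ?F)"
      using potential_cause_arrows_closed by simp
  qed
  then have inv: "fst L \<subseteq> S" "snd L \<subseteq> ?F" "\<And>a T b. (a, T, b) \<in> snd L \<Longrightarrow> T \<subseteq> fst L"
    unfolding fst_conv snd_conv by blast+
  show ?thesis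
  proof (rule not_acyclic_if_successors)
    show "finite (Obs ` fst L :: ('v, 'u) node set)"
      using assms(1) inv(1) finite_subset by blast
    show "(Obs ` fst L :: ('v, 'u) node set) \<noteq> {}"
      using assms(6) by blast
    fix x :: "('v, 'u) node"
    assume "x \<in> Obs ` fst L"
    then obtain a T b where x: "x = Obs a" and arrow: "(a, T, b) \<in> snd L"
      using child by blast
    \<comment> \<open>The descendant lies in the label of a surviving arrow, and such a label stays
      inside the loop graph.\<close>
    then obtain b' where "b' \<in> T" "(x, Obs b') \<in> E\<^sup>+"
      using potential_cause_arrow_ancestor[OF assms(7,2,8-10)] inv(2) by blast
    then show "\<exists>y \<in> Obs ` fst L. (x, y) \<in> E\<^sup>+"
      using inv(3)[OF arrow] by blast
  qed
qed

end
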